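(* If $X \subseteq \omega$ is infinite, then there is a $1$-generic set $A \subseteq \omega$ such that $A \cup X$ is not $1$-generic. That is, there is no infinite union set for $1$-genericity.
   Context: Subsets of $\omega$ are identified with their characteristic functions, i.e. with elements of $2^{\omega}$. For $\sigma \in 2^{<\omega}$ and $G \in 2^{\omega}$, $\sigma \prec G$ means that $\sigma$ is an initial segment of $G$. A set $G \subseteq \omega$ is $1$-generic if for every c.e. set $W \subseteq 2^{<\omega}$ there is $\sigma \prec G$ such that either $\sigma \in W$ or no $\tau \in 2^{<\omega}$ extending $\sigma$ belongs to $W$. A set $X \subseteq \omega$ is a union set for $1$-genericity if for all $1$-generic sets $G$, $G \cup X$ is also $1$-generic. *)

theory Defs
  imports Main "HOL-Library.Nat_Bijection" "HOL-Library.Sublist"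
begin

primrec prim_rec ::
  "(nat \<Rightarrow> nat option) \<Rightarrow> (nat \<Rightarrow> nat option) \<Rightarrow> nat \<Rightarrow> nat \<Rightarrow> nat option" where
  "prim_rec f g a 0 = f a"
| "prim_rec f g a (Suc n) =
     Option.bind (prim_rec f g a n) (\<lambda>r. g (prod_encode (a, prod_encode (n, r))))"

text \<open>The search below diverges if some value of \<open>f\<close> before the first zero is undefined.\<close>

definition mu_search :: "(nat \<Rightarrow> nat option) \<Rightarrow> nat \<Rightarrow> nat option" where
  "mu_search f a =
     (if \<exists>n. f (prod_encode (a, n)) = Some 0 \<and> (\<forall>m<n. f (prod_encode (a, m)) \<noteq> None)
      then Some (LEAST n. f (prod_encode (a, n)) = Some 0)
      else None)"

text \<open>The partial recursive functions in one variable, \<open>None\<close> standing for an undefined value.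
  Several arguments are passed as one number through the Cantor pairing \<open>prod_encode\<close>; its two
  projections are therefore among the initial functions, and pairing is among the closure
  conditions.\<close>

inductive partial_recursive :: "(nat \<Rightarrow> nat option) \<Rightarrow> bool" where
  zero: "partial_recursive (\<lambda>x. Some 0)"
| succ: "partial_recursive (\<lambda>x. Some (Suc x))"
| left: "partial_recursive (\<lambda>x. Some (fst (prod_decode x)))"
| right: "partial_recursive (\<lambda>x. Some (snd (prod_decode x)))"
| pair: "partial_recursive f \<Longrightarrow> partial_recursive g \<Longrightarrow>
    partial_recursive (\<lambda>x. Option.bind (f x) (\<lambda>y. Option.bind (g x) (\<lambda>z. Some (prod_encode (y, z)))))"
| comp: "partial_recursive f \<Longrightarrow> partial_recursive g \<Longrightarrow>
    partial_recursive (\<lambda>x. Option.bind (g x) f)"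
| prec: "partial_recursive f \<Longrightarrow> partial_recursive g \<Longrightarrow>
    partial_recursive (\<lambda>x. prim_rec f g (fst (prod_decode x)) (snd (prod_decode x)))"
| mu: "partial_recursive f \<Longrightarrow> partial_recursive (mu_search f)"

definition string_code :: "bool list \<Rightarrow> nat" where
  "string_code \<sigma> = list_encode (map of_bool \<sigma>)"

text \<open>A set of strings is c.e. if it is the domain of a partial recursive function,
  strings being given to the function by their codes.\<close>

definition ce_strings :: "bool list set \<Rightarrow> bool" where
  "ce_strings W \<longleftrightarrow> (\<exists>f. partial_recursive f \<and> W = {\<sigma>. string_code \<sigma> \<in> dom f})"

definition initial_segment :: "bool list \<Rightarrow> nat set \<Rightarrow> bool" where
  "initial_segment \<sigma> G \<longleftrightarrow> (\<forall>i<length \<sigma>. \<sigma> ! i \<longleftrightarrow> i \<in> G)"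

definition one_generic :: "nat set \<Rightarrow> bool" where
  "one_generic G \<longleftrightarrow>
     (\<forall>W. ce_strings W \<longrightarrow>
       (\<exists>\<sigma>. initial_segment \<sigma> G \<and> (\<sigma> \<in> W \<or> (\<forall>\<tau>. prefix \<sigma> \<tau> \<longrightarrow> \<tau> \<notin> W))))"

definition one_generic_union_set :: "nat set \<Rightarrow> bool" where
  "one_generic_union_set X \<longleftrightarrow> (\<forall>G. one_generic G \<longrightarrow> one_generic (G \<union> X))"

end

theory Submission
  imports Defs
begin

text \<open>
  If \<open>X\<close> has an infinite c.e. subset \<open>C\<close>, then no superset \<open>G\<close> of \<open>X\<close> is 1-generic: the strings
  with a zero at a point of \<open>C\<close> form a c.e. set that \<open>G\<close> never meets, although every string extends
  into it (\<open>not_one_generic_if_infinite_ce_subset\<close>). Any 1-generic \<open>A\<close> then serves.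

  Otherwise \<open>A\<close> is built by finite extension so that \<open>G = A \<union> X\<close> can be read, forever, by an algorithm
  that divides it into stages. The start of a stage always belongs to \<open>G\<close>. The strings that have a zero
  at what the algorithm takes for the start of a stage therefore form a c.e. set that \<open>G\<close> never meets;
  but every initial segment of \<open>G\<close> extends into it, by reading on to the next start and putting a zero
  there. So \<open>G\<close> is not 1-generic (\<open>not_one_generic_if_decoded\<close>).

  For \<open>A\<close> to be 1-generic, the stage that starts with the finite string \<open>\<sigma>\<close> has to reach an extension
  of \<open>\<sigma>\<close> that lies in the \<open>s\<close>-th c.e. set \<open>W\<close>, or one that has no extension in \<open>W\<close>. In the former
  case the algorithm must find out where that extension ends, and it knows \<open>A\<close> only up to elements of
  \<open>X\<close>. The stage therefore begins with ones followed by a zero at a position \<open>i\<close> outside \<open>X\<close> that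
  encodes \<open>s\<close> and \<open>\<sigma>\<close>; such an \<open>i\<close> exists because the computable set of candidates is not a subset of
  \<open>X\<close>. Then come more ones and a zero at a position \<open>k\<close>. Fix a computable set \<open>B\<close> with \<open>X \<inter> B\<close> and
  \<open>- B\<close> infinite. If \<open>k\<close> is in \<open>B\<close>, the algorithm searches for an extension in \<open>W\<close> of the string read
  so far, with \<open>\<sigma>\<close> in the place of what it saw, and lets the stage end with the first one that it
  finds. If \<open>k\<close> is not in \<open>B\<close>, it ends the stage at once.

  This leaves the choice of \<open>k\<close>, and here the infinite set \<open>X \<inter> B\<close> is used (\<open>extension_step\<close>). For
  \<open>k \<in> B\<close> and \<open>j > k\<close> outside \<open>B\<close>, let \<open>\<rho>\<^sub>k\<close> be the extension of \<open>\<sigma>\<close> by ones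
  with zeros at \<open>i\<close> and, at the end, \<open>k\<close>, and let \<open>\<rho>\<^sub>k\<^sub>j\<close> prolong it by ones and a last zero at \<open>j\<close>;
  a suitable \<open>j\<close> outside \<open>X\<close> exists for the same reason as \<open>i\<close>. If \<open>\<rho>\<^sub>k\<close> has an extension in \<open>W\<close> for some \<open>k\<close> outside
  \<open>X\<close>, then \<open>A\<close> can take the first one, and the algorithm will find it. If \<open>k\<close> is in \<open>X\<close>, the union
  hides the zero at \<open>k\<close>, so the algorithm sees ones up to \<open>j\<close> and, for \<open>j\<close> outside \<open>X\<close>, ends the stage
  there; hence if \<open>\<rho>\<^sub>k\<^sub>j\<close> has no extension in \<open>W\<close>, then \<open>A\<close> can take \<open>\<rho>\<^sub>k\<^sub>j\<close>. If neither is ever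
  possible, then an element \<open>k\<close> of \<open>B\<close> beyond \<open>i\<close> is in \<open>X\<close> if and only if some \<open>\<rho>\<^sub>k\<^sub>j\<close> has an extension
  in \<open>W\<close>. That makes an infinite part of \<open>X\<close> c.e., a contradiction.

  The algorithm handles all c.e. sets at once, so it needs a universal partial recursive function. Its
  graph is obtained as the set of facts that are derivable by finitely many decidable rules
  (\<open>evaluates_universal\<close>), and derivations are coded by numbers.
\<close>

section \<open>Computable functions and decidable predicates\<close>

abbreviation pr :: "nat \<Rightarrow> nat \<Rightarrow> nat" where
  "pr a b \<equiv> prod_encode (a, b)"

definition pi1 :: "nat \<Rightarrow> nat" where "pi1 x = fst (prod_decode x)"
definition pi2 :: "nat \<Rightarrow> nat" where "pi2 x = snd (prod_decode x)"

lemma pi_pr [simp]: "pi1 (pr a b) = a" "pi2 (pr a b) = b" "pr (pi1 x) (pi2 x) = x"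
  by (simp_all add: pi1_def pi2_def)

lemma pi_0 [simp]: "pi1 0 = 0" "pi2 0 = 0"
  by (simp_all add: pi1_def pi2_def prod_decode_def prod_decode_aux.simps)

lemma infinite_pi1_fibre: "infinite {i. pi1 i = e}"
proof
  assume "finite {i. pi1 i = e}"
  then have "finite (range (pr e))" by (rule finite_subset[rotated]) auto
  moreover have "inj (pr e)" by (simp add: inj_def)
  ultimately show False using finite_imageD by blast
qed

lemma ex_triple:
  "(\<exists>y. P (pi1 y) (pi1 (pi2 y)) (pi2 (pi2 y))) \<longleftrightarrow> (\<exists>a b c. P a b c)"
  by (metis pi_pr(1,2))

definition computable :: "(nat \<Rightarrow> nat) \<Rightarrow> bool" where
  "computable f \<longleftrightarrow> partial_recursive (\<lambda>x. Some (f x))"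

definition decidable :: "(nat \<Rightarrow> bool) \<Rightarrow> bool" where
  "decidable P \<longleftrightarrow> computable (\<lambda>x. of_bool (P x))"

lemma computable_compose: "computable f \<Longrightarrow> computable g \<Longrightarrow> computable (\<lambda>x. f (g x))"
  unfolding computable_def by (drule (1) partial_recursive.comp) simp

lemma computable_pair: "computable f \<Longrightarrow> computable g \<Longrightarrow> computable (\<lambda>x. pr (f x) (g x))"
  unfolding computable_def by (drule (1) partial_recursive.pair) simp

lemma computable_pi1_id: "computable pi1"
  and computable_pi2_id: "computable pi2"
  unfolding computable_def pi1_def pi2_def
  by (rule partial_recursive.left partial_recursive.right)+

lemma computable_Suc: "computable f \<Longrightarrow> computable (\<lambda>x. Suc (f x))"
  by (rule computable_compose[of Suc f])
    (simp_all add: computable_def partial_recursive.succ)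

lemmas computable_pi1 = computable_compose[OF computable_pi1_id]
lemmas computable_pi2 = computable_compose[OF computable_pi2_id]

lemma computable_id: "computable (\<lambda>x. x)"
  using computable_pair[OF computable_pi1_id computable_pi2_id] by simp

lemma computable_const: "computable (\<lambda>x. c)"
proof (induction c)
  case 0
  show ?case by (simp add: computable_def partial_recursive.zero)
next
  case (Suc c)
  then show ?case by (rule computable_Suc)
qed

lemma prim_rec_total:
  "prim_rec (\<lambda>x. Some (f x)) (\<lambda>z. Some (h z)) a n = Some (rec_nat (f a) (\<lambda>m r. h (pr a (pr m r))) n)"
  by (induction n) simp_all

text \<open>Functions of several arguments are treated as in the primitive recursion below: a parameter \<open>x\<close>
  ranges over the whole argument, and a function that also depends on bound values is required to be
  computable as a function of one number that packs the parameter with them. The closure rules can then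
  be applied backwards to a formula, without any explicit manipulation of tuples.\<close>

lemma computable_rec_nat:
  assumes "computable f" "computable (\<lambda>z. h (pi1 z) (pi1 (pi2 z)) (pi2 (pi2 z)))" "computable n"
  shows "computable (\<lambda>x. rec_nat (f x) (h x) (n x))"
proof -
  let ?h = "\<lambda>z. h (pi1 z) (pi1 (pi2 z)) (pi2 (pi2 z))"
  have "partial_recursive (\<lambda>x. prim_rec (\<lambda>x. Some (f x)) (\<lambda>z. Some (?h z))
          (fst (prod_decode x)) (snd (prod_decode x)))"
    using assms(1,2) unfolding computable_def by (rule partial_recursive.prec)
  then have "computable (\<lambda>x. rec_nat (f (pi1 x)) (h (pi1 x)) (pi2 x))"
    by (simp add: prim_rec_total computable_def pi1_def pi2_def)
  from computable_compose[OF this computable_pair[OF computable_id assms(3)]]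
  show ?thesis by simp
qed

lemma computable_pred:
  assumes "computable f" shows "computable (\<lambda>x. f x - 1)"
proof -
  have "computable (\<lambda>x. rec_nat 0 (\<lambda>m r. m) (f x))"
    by (intro computable_rec_nat computable_const computable_pi1 computable_pi2 computable_id assms)
  moreover have "rec_nat 0 (\<lambda>m r. m) n = n - 1" for n :: nat by (cases n) simp_all
  ultimately show ?thesis by simp
qed

lemma computable_diff:
  assumes "computable f" "computable g" shows "computable (\<lambda>x. f x - g x)"
proof -
  have "computable (\<lambda>x. rec_nat (f x) (\<lambda>m r. r - 1) (g x))"
    by (intro computable_rec_nat computable_pred computable_pi2 computable_id assms)
  moreover have "rec_nat a (\<lambda>m r. r - 1) n = a - n" for a n :: nat by (induction n) simp_all
  ultimately show ?thesis by simp
qed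

lemma computable_if:
  assumes "decidable P" "computable f" "computable g"
  shows "computable (\<lambda>x. if P x then f x else g x)"
proof -
  have "computable (\<lambda>x. rec_nat (g x) (\<lambda>_ _. f x) (of_bool (P x)))"
    using assms(1) unfolding decidable_def
    by (intro computable_rec_nat computable_compose[OF assms(2)] assms computable_pi1 computable_id)
  moreover have "rec_nat (g x) (\<lambda>_ _. f x) (of_bool (P x)) = (if P x then f x else g x)" for x
    by simp
  ultimately show ?thesis by simp
qed

lemma decidable_compose: "decidable P \<Longrightarrow> computable g \<Longrightarrow> decidable (\<lambda>x. P (g x))"
  unfolding decidable_def by (rule computable_compose)

text \<open>Zero tests by truncated subtraction are the source of all comparisons.\<close>

lemma decidable_zero:
  assumes "computable f" shows "decidable (\<lambda>x. f x = 0)"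
proof -
  have "computable (\<lambda>x. 1 - f x)"
    by (intro computable_diff computable_const assms)
  moreover have "1 - f x = of_bool (f x = 0)" for x by simp
  ultimately show ?thesis by (simp add: decidable_def)
qed

lemma decidable_if:
  assumes "decidable P" "decidable Q" "decidable R"
  shows "decidable (\<lambda>x. if P x then Q x else R x)"
  using computable_if[OF assms(1) assms(2,3)[unfolded decidable_def]]
  unfolding decidable_def by (simp only: if_distrib[of of_bool])

lemma decidable_const: "decidable (\<lambda>x. c)"
  unfolding decidable_def by (rule computable_const)

lemma if_bool:
  "(if p then False else True) \<longleftrightarrow> \<not> p"
  "(if p then q else False) \<longleftrightarrow> p \<and> q"
  "(if p then True else q) \<longleftrightarrow> p \<or> q"
  "(if p then q else True) \<longleftrightarrow> (p \<longrightarrow> q)"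
  by simp_all

lemma decidable_not: "decidable P \<Longrightarrow> decidable (\<lambda>x. \<not> P x)"
  using decidable_if[of P "\<lambda>x. False" "\<lambda>x. True"] decidable_const by (simp add: if_bool)

lemma decidable_conj: "decidable P \<Longrightarrow> decidable Q \<Longrightarrow> decidable (\<lambda>x. P x \<and> Q x)"
  using decidable_if[of P Q "\<lambda>x. False"] decidable_const by (simp add: if_bool)

lemma decidable_disj: "decidable P \<Longrightarrow> decidable Q \<Longrightarrow> decidable (\<lambda>x. P x \<or> Q x)"
  using decidable_if[of P "\<lambda>x. True" Q] decidable_const by (simp add: if_bool)

lemma decidable_imp: "decidable P \<Longrightarrow> decidable Q \<Longrightarrow> decidable (\<lambda>x. P x \<longrightarrow> Q x)"
  using decidable_if[of P Q "\<lambda>x. True"] decidable_const by (simp add: if_bool)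

lemma decidable_le:
  assumes "computable f" "computable g" shows "decidable (\<lambda>x. f x \<le> g x)"
  using decidable_zero[OF computable_diff[OF assms]] by simp

lemma decidable_less:
  assumes "computable f" "computable g" shows "decidable (\<lambda>x. f x < g x)"
  using decidable_le[OF computable_Suc[OF assms(1)] assms(2)] by (simp add: Suc_le_eq)

lemma decidable_eq:
  assumes "computable f" "computable g" shows "decidable (\<lambda>x. f x = g x)"
  using decidable_conj[OF decidable_le[OF assms] decidable_le[OF assms(2,1)]]
  by (simp add: eq_iff)

lemma decidable_bex:
  assumes "decidable (\<lambda>z. P (pi1 z) (pi2 z))" "computable f"
  shows "decidable (\<lambda>x. \<exists>y<f x. P x y)"
proof -
  have "computable (\<lambda>z. of_bool (P (pi1 z) (pi1 (pi2 z)) \<or> pi2 (pi2 z) \<noteq> 0))"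
    using decidable_compose[OF assms(1), of "\<lambda>z. pr (pi1 z) (pi1 (pi2 z))"]
    unfolding decidable_def[symmetric]
    by (intro decidable_disj decidable_not decidable_zero)
      (simp_all add: computable_pair computable_pi1 computable_pi2 computable_id)
  then have "computable (\<lambda>x. rec_nat 0 (\<lambda>m r. of_bool (P x m \<or> r \<noteq> 0)) (f x))"
    by (intro computable_rec_nat computable_const assms)
  moreover have "rec_nat 0 (\<lambda>m r. of_bool (P x m \<or> r \<noteq> 0)) n = (of_bool (\<exists>y<n. P x y) :: nat)" for x n
    by (induction n) (auto simp: less_Suc_eq)
  ultimately show ?thesis by (simp add: decidable_def)
qed

lemma decidable_ball:
  assumes "decidable (\<lambda>z. P (pi1 z) (pi2 z))" "computable f"
  shows "decidable (\<lambda>x. \<forall>y<f x. P x y)"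
  using decidable_not[OF decidable_bex[OF decidable_not[OF assms(1)] assms(2)]] by simp

lemmas rec_intros = computable_const computable_id computable_pi1 computable_pi2 computable_pair
  computable_Suc computable_pred computable_if
  decidable_const decidable_if decidable_not decidable_conj decidable_disj decidable_imp decidable_le
  decidable_less decidable_eq decidable_bex decidable_ball

section \<open>Coded lists\<close>

text \<open>The code of \<open>x # xs\<close> is one more than the code of the pair of \<open>x\<close> and the code of \<open>xs\<close>, so
  \<open>r - 1\<close> undoes the successor. Codes of lists that are used up stay at 0, the code of the empty list:
  this is what makes \<open>entry_tail\<close> vanish exactly from the length of the list on.\<close>

definition entry_tail :: "nat \<Rightarrow> nat \<Rightarrow> nat" where
  "entry_tail c m = rec_nat c (\<lambda>_ r. pi2 (r - 1)) m"

definition entry :: "nat \<Rightarrow> nat \<Rightarrow> nat" where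
  "entry c m = pi1 (entry_tail c m - 1)"

lemma computable_entry_tail:
  "computable f \<Longrightarrow> computable g \<Longrightarrow> computable (\<lambda>x. entry_tail (f x) (g x))"
  unfolding entry_tail_def by (intro computable_rec_nat rec_intros)

lemma computable_entry:
  "computable f \<Longrightarrow> computable g \<Longrightarrow> computable (\<lambda>x. entry (f x) (g x))"
  unfolding entry_def by (intro computable_entry_tail rec_intros)

lemma entry_tail_list_encode: "entry_tail (list_encode xs) m = list_encode (drop m xs)"
proof (induction m)
  case (Suc m)
  have "pi2 (list_encode ys - 1) = list_encode (tl ys)" for ys
    by (cases ys) simp_all
  then show ?case
    using Suc by (simp add: entry_tail_def drop_Suc tl_drop)
qed (simp add: entry_tail_def)

lemma entry_tail_eq_0_iff: "entry_tail (list_encode xs) m = 0 \<longleftrightarrow> length xs \<le> m"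
proof -
  have "list_encode ys = 0 \<longleftrightarrow> ys = []" for ys by (cases ys) simp_all
  then show ?thesis by (simp add: entry_tail_list_encode)
qed

lemma entry_list_encode: "entry (list_encode xs) m = (if m < length xs then xs ! m else 0)"
proof (cases "m < length xs")
  case True
  then show ?thesis
    by (simp add: entry_def entry_tail_list_encode Cons_nth_drop_Suc[symmetric])
qed (simp add: entry_def entry_tail_list_encode)

section \<open>Derivability from decidable rules is c.e.\<close>

inductive derivable :: "(nat \<Rightarrow> bool) \<Rightarrow> (nat \<Rightarrow> nat \<Rightarrow> nat \<Rightarrow> bool) \<Rightarrow> nat \<Rightarrow> bool" for Ax R where
  axiom: "Ax c \<Longrightarrow> derivable Ax R c"
| rule: "derivable Ax R p \<Longrightarrow> derivable Ax R q \<Longrightarrow> R p q c \<Longrightarrow> derivable Ax R c"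

text \<open>The list coded by \<open>d\<close>, cut off after position \<open>n\<close>, as a proof in the style of Hilbert. All
  quantifiers are bounded, so that this is decidable whenever the axioms and the rules are.\<close>

definition derivation :: "(nat \<Rightarrow> bool) \<Rightarrow> (nat \<Rightarrow> nat \<Rightarrow> nat \<Rightarrow> bool) \<Rightarrow> nat \<Rightarrow> nat \<Rightarrow> bool" where
  "derivation Ax R d n \<longleftrightarrow>
     (\<forall>m<Suc n. Ax (entry d m) \<or> (\<exists>j<m. \<exists>k<m. R (entry d j) (entry d k) (entry d m)))"

definition justified :: "(nat \<Rightarrow> bool) \<Rightarrow> (nat \<Rightarrow> nat \<Rightarrow> nat \<Rightarrow> bool) \<Rightarrow> nat list \<Rightarrow> bool" where
  "justified Ax R xs \<longleftrightarrow>
     (\<forall>m<length xs. Ax (xs ! m) \<or> (\<exists>j<m. \<exists>k<m. R (xs ! j) (xs ! k) (xs ! m)))"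

lemma justified_snoc:
  "justified Ax R (xs @ [c]) \<longleftrightarrow>
     justified Ax R xs \<and> (Ax c \<or> (\<exists>p\<in>set xs. \<exists>q\<in>set xs. R p q c))"
proof -
  have "(\<forall>m<Suc (length xs). Q m) \<longleftrightarrow> (\<forall>m<length xs. Q m) \<and> Q (length xs)" for Q
    by (auto simp: less_Suc_eq)
  then show ?thesis
    by (simp add: justified_def nth_append Bex_def in_set_conv_nth cong: conj_cong) blast
qed

lemma justified_append:
  "justified Ax R xs \<Longrightarrow> justified Ax R ys \<Longrightarrow> justified Ax R (xs @ ys)"
proof (induction ys rule: rev_induct)
  case (snoc c ys)
  then have "justified Ax R ((xs @ ys) @ [c])"
    unfolding justified_snoc by auto
  then show ?case by simp
qed simp

lemma derivation_iff_justified: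
  "derivation Ax R d n \<longleftrightarrow> justified Ax R (map (entry d) [0..<Suc n])"
  unfolding derivation_def justified_def
  by (simp del: upt_Suc cong: conj_cong imp_cong)

lemma derivable_iff_derivation:
  "derivable Ax R c \<longleftrightarrow> (\<exists>d n. derivation Ax R d n \<and> entry d n = c)"
proof
  assume "derivable Ax R c"
  then have "\<exists>xs. justified Ax R (xs @ [c])"
  proof induction
    case (axiom c)
    then have "justified Ax R ([] @ [c])" by (simp add: justified_def)
    then show ?case by blast
  next
    case (rule p q c)
    then obtain xs ys where "justified Ax R (xs @ [p])" "justified Ax R (ys @ [q])" by blast
    then have "justified Ax R ((xs @ [p]) @ (ys @ [q]))" by (rule justified_append)
    then have "justified Ax R (((xs @ [p]) @ (ys @ [q])) @ [c])"
      using rule.hyps(3) unfolding justified_snoc[of _ _ _ c] by auto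
    then show ?case by blast
  qed
  then obtain xs where xs: "justified Ax R (xs @ [c])" by blast
  have "map (entry (list_encode (xs @ [c]))) [0..<Suc (length xs)] = xs @ [c]"
    by (rule nth_equalityI) (simp_all add: entry_list_encode del: upt_Suc)
  then have "derivation Ax R (list_encode (xs @ [c])) (length xs)"
    using xs by (simp only: derivation_iff_justified)
  moreover have "entry (list_encode (xs @ [c])) (length xs) = c"
    by (simp add: entry_list_encode)
  ultimately show "\<exists>d n. derivation Ax R d n \<and> entry d n = c" by blast
next
  assume "\<exists>d n. derivation Ax R d n \<and> entry d n = c"
  then obtain d n where d: "justified Ax R (map (entry d) [0..<Suc n])" "entry d n = c"
    unfolding derivation_iff_justified by blast
  have "justified Ax R xs \<Longrightarrow> \<forall>c\<in>set xs. derivable Ax R c" for xs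
    by (induction xs rule: rev_induct) (auto simp: justified_snoc intro: derivable.intros)
  from this[OF d(1)] show "derivable Ax R c" using d(2) by simp
qed

section \<open>A universal partial recursive function\<close>

text \<open>A fact \<open>pr e (pr x y)\<close> says that the program \<open>e\<close> yields \<open>y\<close> on the argument \<open>x\<close>. The first
  component of \<open>e\<close> is the kind of program: 0 to 7 are the clauses of \<open>partial_recursive\<close> in their
  order. Unbounded search has a varying number of premises, which the auxiliary kind 8 collects: its
  facts say that a program has defined nonzero values at all search positions below a bound.\<close>

definition eval_axiom :: "nat \<Rightarrow> bool" where
  "eval_axiom c \<longleftrightarrow> (let e = pi1 c; x = pi1 (pi2 c); y = pi2 (pi2 c) in
     pi1 e = 0 \<and> y = 0 \<or>
     pi1 e = 1 \<and> y = Suc x \<or>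
     pi1 e = 2 \<and> y = pi1 x \<or>
     pi1 e = 3 \<and> y = pi2 x \<or>
     pi1 e = 8 \<and> pi2 x = 0 \<and> y = 0)"

definition eval_rule :: "nat \<Rightarrow> nat \<Rightarrow> nat \<Rightarrow> bool" where
  "eval_rule p q c \<longleftrightarrow> (let e = pi1 c; x = pi1 (pi2 c); y = pi2 (pi2 c);
       f = pi1 (pi2 e); g = pi2 (pi2 e); u = pi2 (pi2 p); v = pi2 (pi2 q); n = pi2 x - 1 in
     pi1 e = 4 \<and> p = pr f (pr x u) \<and> q = pr g (pr x v) \<and> y = pr u v \<or>
     pi1 e = 5 \<and> p = pr g (pr x u) \<and> q = pr f (pr u y) \<or>
     pi1 e = 6 \<and> pi2 x = 0 \<and> p = pr f (pr (pi1 x) y) \<or>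
     pi1 e = 6 \<and> pi2 x \<noteq> 0 \<and> p = pr e (pr (pr (pi1 x) n) u) \<and> q = pr g (pr (pr (pi1 x) (pr n u)) y) \<or>
     pi1 e = 7 \<and> p = pr (pr 8 (pi2 e)) (pr (pr x y) 0) \<and> q = pr (pi2 e) (pr (pr x y) 0) \<or>
     pi1 e = 8 \<and> pi2 x \<noteq> 0 \<and> y = 0 \<and> p = pr e (pr (pr (pi1 x) n) 0) \<and>
       q = pr (pi2 e) (pr (pr (pi1 x) n) v) \<and> v \<noteq> 0)"

definition evaluates :: "nat \<Rightarrow> nat \<Rightarrow> nat \<Rightarrow> bool" where
  "evaluates e x y \<longleftrightarrow> derivable eval_axiom eval_rule (pr e (pr x y))"

lemma evaluates_unfold:
  "evaluates e x y \<longleftrightarrow> eval_axiom (pr e (pr x y)) \<or>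
     (\<exists>e' x' y' e'' x'' y''. evaluates e' x' y' \<and> evaluates e'' x'' y'' \<and>
       eval_rule (pr e' (pr x' y')) (pr e'' (pr x'' y'')) (pr e (pr x y)))"
  unfolding evaluates_def by (subst derivable.simps) (metis pi_pr(3))

lemma evaluates_basic:
  "evaluates (pr 0 a) x y \<longleftrightarrow> y = 0"
  "evaluates (pr 1 a) x y \<longleftrightarrow> y = Suc x"
  "evaluates (pr 2 a) x y \<longleftrightarrow> y = pi1 x"
  "evaluates (pr 3 a) x y \<longleftrightarrow> y = pi2 x"
  by (subst evaluates_unfold, simp add: eval_axiom_def eval_rule_def)+

lemma evaluates_pair:
  "evaluates (pr 4 (pr f g)) x y \<longleftrightarrow> (\<exists>u v. evaluates f x u \<and> evaluates g x v \<and> y = pr u v)"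
  by (subst evaluates_unfold) (auto simp: eval_axiom_def eval_rule_def)

lemma evaluates_comp:
  "evaluates (pr 5 (pr f g)) x y \<longleftrightarrow> (\<exists>u. evaluates g x u \<and> evaluates f u y)"
  by (subst evaluates_unfold) (auto simp: eval_axiom_def eval_rule_def)

lemma evaluates_prec_0:
  "evaluates (pr 6 (pr f g)) (pr a 0) y \<longleftrightarrow> evaluates f a y"
  by (subst evaluates_unfold) (auto simp: eval_axiom_def eval_rule_def)

lemma evaluates_prec_Suc:
  "evaluates (pr 6 (pr f g)) (pr a (Suc n)) y \<longleftrightarrow>
     (\<exists>r. evaluates (pr 6 (pr f g)) (pr a n) r \<and> evaluates g (pr a (pr n r)) y)"
  by (subst evaluates_unfold) (auto simp: eval_axiom_def eval_rule_def)

lemma evaluates_mu: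
  "evaluates (pr 7 f) x y \<longleftrightarrow> evaluates (pr 8 f) (pr x y) 0 \<and> evaluates f (pr x y) 0"
  by (subst evaluates_unfold) (auto simp: eval_axiom_def eval_rule_def)

lemma evaluates_nonzero_below:
  "evaluates (pr 8 f) (pr x n) 0 \<longleftrightarrow> (\<forall>m<n. \<exists>v. evaluates f (pr x m) (Suc v))"
proof (induction n)
  case 0
  show ?case by (subst evaluates_unfold) (simp add: eval_axiom_def)
next
  case (Suc n)
  have "evaluates (pr 8 f) (pr x (Suc n)) 0 \<longleftrightarrow>
      evaluates (pr 8 f) (pr x n) 0 \<and> (\<exists>v. evaluates f (pr x n) (Suc v))"
    by (subst evaluates_unfold) (auto simp: eval_axiom_def eval_rule_def gr0_conv_Suc; blast)
  then show ?case by (auto simp: Suc less_Suc_eq)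
qed

text \<open>The form of \<open>mu_search\<close> that matches its derivations: the conditions that all values before
  the first zero are defined and that it is the first are merged.\<close>

lemma mu_search_eq_Some_iff:
  "mu_search f x = Some y \<longleftrightarrow>
     f (pr x y) = Some 0 \<and> (\<forall>m<y. \<exists>v. f (pr x m) = Some (Suc v))"
proof
  assume "mu_search f x = Some y"
  then have ex: "\<exists>n. f (pr x n) = Some 0 \<and> (\<forall>m<n. f (pr x m) \<noteq> None)"
    and y: "y = (LEAST n. f (pr x n) = Some 0)"
    by (auto simp: mu_search_def split: if_splits)
  from ex obtain n where n: "f (pr x n) = Some 0" "\<forall>m<n. f (pr x m) \<noteq> None" by blast
  have "f (pr x y) = Some 0" unfolding y by (rule LeastI[of _ n]) (rule n(1))
  moreover have "y \<le> n" unfolding y using n(1) by (rule Least_le)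
  moreover have "f (pr x m) \<noteq> Some 0" if "m < y" for m
    using that unfolding y by (rule not_less_Least)
  ultimately show "f (pr x y) = Some 0 \<and> (\<forall>m<y. \<exists>v. f (pr x m) = Some (Suc v))"
    using n(2) by (metis not0_implies_Suc option.exhaust order.strict_trans2)
next
  assume y: "f (pr x y) = Some 0 \<and> (\<forall>m<y. \<exists>v. f (pr x m) = Some (Suc v))"
  have "(LEAST n. f (pr x n) = Some 0) = y"
  proof (rule Least_equality)
    show "f (pr x y) = Some 0" using y by blast
    fix n assume n: "f (pr x n) = Some 0"
    show "y \<le> n"
    proof (rule ccontr)
      assume "\<not> y \<le> n"
      then obtain v where "f (pr x n) = Some (Suc v)" using y by force
      with n show False by simp
    qed
  qed
  moreover have "\<exists>n. f (pr x n) = Some 0 \<and> (\<forall>m<n. f (pr x m) \<noteq> None)"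
    using y by (intro exI[of _ y]) force
  ultimately show "mu_search f x = Some y" by (simp add: mu_search_def)
qed

lemma evaluates_universal:
  "partial_recursive f \<Longrightarrow> \<exists>e. \<forall>x y. evaluates e x y \<longleftrightarrow> f x = Some y"
proof (induction rule: partial_recursive.induct)
  case zero
  show ?case using evaluates_basic(1) by (intro exI[of _ "pr 0 0"]) auto
next
  case succ
  show ?case using evaluates_basic(2) by (intro exI[of _ "pr 1 0"]) auto
next
  case left
  show ?case using evaluates_basic(3) by (intro exI[of _ "pr 2 0"]) (auto simp: pi1_def)
next
  case right
  show ?case using evaluates_basic(4) by (intro exI[of _ "pr 3 0"]) (auto simp: pi2_def)
next
  case (pair f g)
  then obtain a b where "\<forall>x y. evaluates a x y \<longleftrightarrow> f x = Some y"
    "\<forall>x y. evaluates b x y \<longleftrightarrow> g x = Some y" by blast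
  then show ?case
    by (intro exI[of _ "pr 4 (pr a b)"]) (auto simp: evaluates_pair bind_eq_Some_conv)
next
  case (comp f g)
  then obtain a b where "\<forall>x y. evaluates a x y \<longleftrightarrow> f x = Some y"
    "\<forall>x y. evaluates b x y \<longleftrightarrow> g x = Some y" by blast
  then show ?case
    by (intro exI[of _ "pr 5 (pr a b)"]) (auto simp: evaluates_comp bind_eq_Some_conv)
next
  case (prec f g)
  then obtain a b where ab: "\<forall>x y. evaluates a x y \<longleftrightarrow> f x = Some y"
    "\<forall>x y. evaluates b x y \<longleftrightarrow> g x = Some y" by blast
  have "evaluates (pr 6 (pr a b)) (pr c n) y \<longleftrightarrow> prim_rec f g c n = Some y" for c n y
    by (induction n arbitrary: y)
      (auto simp: ab evaluates_prec_0 evaluates_prec_Suc bind_eq_Some_conv)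
  then have "evaluates (pr 6 (pr a b)) x y \<longleftrightarrow> prim_rec f g (pi1 x) (pi2 x) = Some y" for x y
    by (metis pi_pr(3))
  then show ?case unfolding pi1_def pi2_def by blast
next
  case (mu f)
  then obtain a where "\<forall>x y. evaluates a x y \<longleftrightarrow> f x = Some y" by blast
  then show ?case
    by (intro exI[of _ "pr 7 a"])
      (auto simp: evaluates_mu evaluates_nonzero_below mu_search_eq_Some_iff)
qed


lemma decidable_eval_axiom: "computable c \<Longrightarrow> decidable (\<lambda>x. eval_axiom (c x))"
  unfolding eval_axiom_def Let_def by (intro rec_intros)

lemma decidable_eval_rule:
  "computable p \<Longrightarrow> computable q \<Longrightarrow> computable c \<Longrightarrow> decidable (\<lambda>x. eval_rule (p x) (q x) (c x))"
  unfolding eval_rule_def Let_def by (intro rec_intros)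

lemma decidable_derivation:
  assumes "decidable (\<lambda>z. Ax (pi1 z) (pi2 z))"
    and "decidable (\<lambda>z. R (pi1 z) (pi1 (pi2 z)) (pi1 (pi2 (pi2 z))) (pi2 (pi2 (pi2 z))))"
    and "computable a" "computable d" "computable n"
  shows "decidable (\<lambda>x. derivation (Ax (a x)) (R (a x)) (d x) (n x))"
proof -
  have Ax: "decidable (\<lambda>x. Ax (f x) (g x))" if "computable f" "computable g" for f g
    using decidable_compose[OF assms(1) computable_pair[OF that]] by simp
  have R: "decidable (\<lambda>x. R (f x) (g x) (h x) (k x))"
    if "computable f" "computable g" "computable h" "computable k" for f g h k
    using decidable_compose[OF assms(2) computable_pair[OF that(1)
      computable_pair[OF that(2) computable_pair[OF that(3,4)]]]] by simp
  show ?thesis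
    unfolding derivation_def
    by (intro rec_intros Ax R computable_entry assms(3-5)
        computable_compose[OF assms(3)] computable_compose[OF assms(4)])
qed

text \<open>The number \<open>w\<close> witnesses that the program \<open>s\<close> halts on \<open>c\<close>: it consists of a derivation and the
  position of a fact about \<open>s\<close> and \<open>c\<close> in it. This is Kleene's T-predicate.\<close>

definition halts :: "nat \<Rightarrow> nat \<Rightarrow> nat \<Rightarrow> bool" where
  "halts s c w \<longleftrightarrow> derivation eval_axiom eval_rule (pi1 w) (pi2 w) \<and>
     pi1 (entry (pi1 w) (pi2 w)) = s \<and> pi1 (pi2 (entry (pi1 w) (pi2 w))) = c"

lemma decidable_halts:
  assumes "computable f" "computable g" "computable h"
  shows "decidable (\<lambda>x. halts (f x) (g x) (h x))"
proof -
  have "decidable (\<lambda>x. derivation eval_axiom eval_rule (pi1 (h x)) (pi2 (h x)))"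
    by (rule decidable_derivation[where a = "\<lambda>x. 0"])
      (intro decidable_eval_axiom decidable_eval_rule rec_intros assms)+
  then show ?thesis
    unfolding halts_def by (intro rec_intros computable_entry assms)
qed

lemma ex_halts_iff: "(\<exists>w. halts e x w) \<longleftrightarrow> (\<exists>y. evaluates e x y)"
proof
  assume "\<exists>w. halts e x w"
  then obtain w where w: "derivation eval_axiom eval_rule (pi1 w) (pi2 w)"
    "pi1 (entry (pi1 w) (pi2 w)) = e" "pi1 (pi2 (entry (pi1 w) (pi2 w))) = x"
    unfolding halts_def by blast
  then have "entry (pi1 w) (pi2 w) = pr e (pr x (pi2 (pi2 (entry (pi1 w) (pi2 w)))))"
    by (metis pi_pr(3))
  then show "\<exists>y. evaluates e x y"
    unfolding evaluates_def derivable_iff_derivation using w(1) by blast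
next
  assume "\<exists>y. evaluates e x y"
  then obtain y d n where "derivation eval_axiom eval_rule d n" "entry d n = pr e (pr x y)"
    unfolding evaluates_def derivable_iff_derivation by blast
  then have "halts e x (pr d n)" by (simp add: halts_def)
  then show "\<exists>w. halts e x w" by blast
qed

lemma ce_strings_index:
  assumes "ce_strings W"
  obtains s where "\<And>\<sigma>. \<sigma> \<in> W \<longleftrightarrow> (\<exists>w. halts s (string_code \<sigma>) w)"
proof -
  obtain f where f: "partial_recursive f" "W = {\<sigma>. string_code \<sigma> \<in> dom f}"
    using assms unfolding ce_strings_def by blast
  obtain s where "\<forall>x y. evaluates s x y \<longleftrightarrow> f x = Some y"
    using evaluates_universal[OF f(1)] by blast
  then have "\<sigma> \<in> W \<longleftrightarrow> (\<exists>w. halts s (string_code \<sigma>) w)" for \<sigma>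
    unfolding ex_halts_iff by (auto simp: f(2))
  then show thesis by (rule that)
qed

lemma ce_strings_projection:
  assumes "decidable R"
  shows "ce_strings {\<sigma>. \<exists>y. R (pr (string_code \<sigma>) y)}"
proof -
  let ?f = "\<lambda>x. Some (if R x then 0 else 1 :: nat)"
  have "partial_recursive ?f"
    using computable_if[OF assms computable_const computable_const] unfolding computable_def .
  then have "partial_recursive (mu_search ?f)" by (rule partial_recursive.mu)
  moreover have "x \<in> dom (mu_search ?f) \<longleftrightarrow> (\<exists>y. R (pr x y))" for x
    by (auto simp: mu_search_def split: if_splits)
  ultimately show ?thesis unfolding ce_strings_def by blast
qed

section \<open>Strings, c.e. sets and generic sets\<close>

definition bits :: "nat \<Rightarrow> nat set" where
  "bits c = {m. entry c m \<noteq> 0}"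

definition string_set :: "bool list \<Rightarrow> nat set" where
  "string_set \<sigma> = {m. m < length \<sigma> \<and> \<sigma> ! m}"

lemma bits_string_code [simp]: "bits (string_code \<sigma>) = string_set \<sigma>"
  by (auto simp: bits_def string_set_def string_code_def entry_list_encode)

lemma entry_tail_string_code [simp]:
  "entry_tail (string_code \<sigma>) m = 0 \<longleftrightarrow> length \<sigma> \<le> m"
  "0 < entry_tail (string_code \<sigma>) m \<longleftrightarrow> m < length \<sigma>"
  by (simp_all add: string_code_def entry_tail_eq_0_iff flip: neq0_conv not_le)

lemma decidable_mem_bits:
  "computable f \<Longrightarrow> computable g \<Longrightarrow> decidable (\<lambda>x. f x \<in> bits (g x))"
  unfolding bits_def mem_Collect_eq by (intro rec_intros computable_entry)

text \<open>The bound \<open>m < c\<close> makes the condition decidable; it reaches all entries because a code is at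
  least as large as the length of its list.\<close>

lemma range_string_code: "c \<in> range string_code \<longleftrightarrow> (\<forall>m<c. entry c m < 2)"
proof
  assume "c \<in> range string_code"
  then show "\<forall>m<c. entry c m < 2"
    by (auto simp: string_code_def entry_list_encode)
next
  assume small: "\<forall>m<c. entry c m < 2"
  define xs where "xs = list_decode c"
  have c: "c = list_encode xs" by (simp add: xs_def)
  have "length ys \<le> list_encode ys" for ys
  proof (induction ys)
    case (Cons y ys)
    then show ?case using le_prod_encode_2[of "list_encode ys" y] by simp
  qed simp
  then have "length xs \<le> c" unfolding c .
  then have "xs ! m < 2" if "m < length xs" for m
    using small that unfolding c by (metis entry_list_encode order.strict_trans2)
  then have "x < 2" if "x \<in> set xs" for x
    using that by (metis in_set_conv_nth)
  then have "map of_bool (map (\<lambda>x. x \<noteq> 0) xs) = xs"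
    by (force intro!: map_idI simp: less_2_cases_iff)
  then show "c \<in> range string_code"
    unfolding c string_code_def by (metis rangeI)
qed

lemma decidable_range_string_code:
  assumes "computable f" shows "decidable (\<lambda>x. f x \<in> range string_code)"
  unfolding range_string_code
  by (intro rec_intros computable_entry assms computable_compose[OF assms])

definition ce_set :: "nat set \<Rightarrow> bool" where
  "ce_set C \<longleftrightarrow> (\<exists>R. decidable R \<and> C = {x. \<exists>y. R (pr x y)})"

lemma ce_set_decidable:
  assumes "decidable (\<lambda>x. x \<in> C)"
  shows "ce_set C"
  unfolding ce_set_def
  by (intro exI[of _ "\<lambda>z. pi1 z \<in> C"] conjI decidable_compose[OF assms] rec_intros) simp

text \<open>A set that includes \<open>C\<close> avoids the c.e. set of strings with a zero at some point of \<open>C\<close>, but as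
  \<open>C\<close> is infinite, enough zeros lead from any string into that set.\<close>

lemma not_one_generic_if_infinite_ce_subset:
  assumes "ce_set C" "infinite C" "C \<subseteq> G"
  shows "\<not> one_generic G"
proof
  assume gen: "one_generic G"
  obtain R where R: "decidable R" "C = {x. \<exists>y. R (pr x y)}"
    using assms(1) unfolding ce_set_def by blast
  define W where "W = {\<sigma>. \<exists>m\<in>C. m < length \<sigma> \<and> \<not> \<sigma> ! m}"
  let ?S = "\<lambda>z. entry_tail (pi1 z) (pi1 (pi2 z)) \<noteq> 0 \<and> pi1 (pi2 z) \<notin> bits (pi1 z) \<and> R (pi2 z)"
  have "decidable ?S"
    by (intro rec_intros computable_entry_tail decidable_mem_bits decidable_compose[OF R(1)])
  then have "ce_strings {\<sigma>. \<exists>y. ?S (pr (string_code \<sigma>) y)}" by (rule ce_strings_projection)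
  moreover have "W = {\<sigma>. \<exists>y. ?S (pr (string_code \<sigma>) y)}"
  proof -
    have "(\<exists>m\<in>C. m < length \<sigma> \<and> \<not> \<sigma> ! m) \<longleftrightarrow> (\<exists>y. ?S (pr (string_code \<sigma>) y))" for \<sigma>
      unfolding R(2) by (auto simp: string_set_def not_le) (metis pi_pr)+
    then show ?thesis unfolding W_def by simp
  qed
  ultimately have "ce_strings W" by simp
  then obtain \<sigma> where \<sigma>: "initial_segment \<sigma> G" "\<sigma> \<in> W \<or> (\<forall>\<tau>. prefix \<sigma> \<tau> \<longrightarrow> \<tau> \<notin> W)"
    using gen unfolding one_generic_def by blast
  have "\<sigma> \<notin> W" using \<sigma>(1) assms(3) by (auto simp: W_def initial_segment_def)
  obtain m where m: "m \<in> C" "length \<sigma> \<le> m"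
    using assms(2) by (metis finite_nat_set_iff_bounded not_le)
  have "\<sigma> @ replicate (Suc m - length \<sigma>) False \<in> W"
    unfolding W_def using m by (auto simp: nth_append intro!: bexI[of _ m])
  with \<sigma>(2) \<open>\<sigma> \<notin> W\<close> show False by force
qed

section \<open>The decoding algorithm\<close>

definition block :: "nat set \<Rightarrow> nat \<Rightarrow> nat \<Rightarrow> bool" where
  "block G a b \<longleftrightarrow> b \<notin> G \<and> (\<forall>m<b. a \<le> m \<longrightarrow> m \<in> G)"

lemma block_unique: "block G a b \<Longrightarrow> block G a b' \<Longrightarrow> a \<le> b \<Longrightarrow> a \<le> b' \<Longrightarrow> b = b'"
  unfolding block_def by (metis linorder_neqE_nat)

lemma block_cong: "G \<inter> {..<n} = H \<inter> {..<n} \<Longrightarrow> b < n \<Longrightarrow> block G a b \<longleftrightarrow> block H a b"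
  unfolding block_def set_eq_iff Int_iff lessThan_iff by (metis order.strict_trans)

lemma decidable_block:
  assumes "computable f" "computable g" "computable h"
  shows "decidable (\<lambda>x. block (bits (f x)) (g x) (h x))"
  unfolding block_def
  by (intro rec_intros decidable_mem_bits assms computable_compose[OF assms(1)]
      computable_compose[OF assms(2)])

text \<open>The zero lands at position \<open>i\<close> provided that \<open>i\<close> is not inside \<open>\<sigma>\<close>.\<close>

definition mark :: "bool list \<Rightarrow> nat \<Rightarrow> bool list" where
  "mark \<sigma> i = \<sigma> @ replicate (i - length \<sigma>) True @ [False]"

lemma length_mark [simp]: "length \<sigma> \<le> i \<Longrightarrow> length (mark \<sigma> i) = Suc i"
  by (simp add: mark_def)

lemma prefix_iff_string_set:
  "prefix \<sigma> \<tau> \<longleftrightarrow> length \<sigma> \<le> length \<tau> \<and> (\<forall>m<length \<sigma>. m \<in> string_set \<tau> \<longleftrightarrow> m \<in> string_set \<sigma>)"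
proof
  assume "prefix \<sigma> \<tau>"
  then show "length \<sigma> \<le> length \<tau> \<and> (\<forall>m<length \<sigma>. m \<in> string_set \<tau> \<longleftrightarrow> m \<in> string_set \<sigma>)"
    by (auto simp: prefix_def string_set_def nth_append)
next
  assume *: "length \<sigma> \<le> length \<tau> \<and> (\<forall>m<length \<sigma>. m \<in> string_set \<tau> \<longleftrightarrow> m \<in> string_set \<sigma>)"
  then have "\<sigma> = take (length \<sigma>) \<tau>"
    by (intro nth_equalityI) (auto simp: string_set_def)
  then show "prefix \<sigma> \<tau>" by (metis take_is_prefix)
qed

lemma prefix_mark_iff:
  assumes "length \<sigma> \<le> i"
  shows "prefix (mark \<sigma> i) \<tau> \<longleftrightarrow>
    prefix \<sigma> \<tau> \<and> i < length \<tau> \<and> block (string_set \<tau>) (length \<sigma>) i"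
proof -
  have bits: "m \<in> string_set (mark \<sigma> i) \<longleftrightarrow> m \<in> string_set \<sigma> \<or> length \<sigma> \<le> m \<and> m < i" for m
    using assms by (auto simp: string_set_def mark_def nth_append nth_Cons')
  have "(\<forall>m<Suc i. m \<in> string_set \<tau> \<longleftrightarrow> m \<in> string_set (mark \<sigma> i)) \<longleftrightarrow>
      (\<forall>m<length \<sigma>. m \<in> string_set \<tau> \<longleftrightarrow> m \<in> string_set \<sigma>) \<and> block (string_set \<tau>) (length \<sigma>) i"
    (is "?L \<longleftrightarrow> ?R")
  proof
    assume L: ?L
    have "i \<notin> string_set \<sigma>" using assms by (simp add: string_set_def)
    with L assms show ?R
      unfolding block_def bits by (auto simp: less_Suc_eq)
  next
    assume R: ?R
    show ?L
    proof (intro allI impI)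
      fix m assume "m < Suc i"
      then consider "m < length \<sigma>" | "length \<sigma> \<le> m" "m < i" | "m = i" by linarith
      then show "m \<in> string_set \<tau> \<longleftrightarrow> m \<in> string_set (mark \<sigma> i)"
        using R assms unfolding bits block_def by cases (auto simp: string_set_def)
    qed
  qed
  then show ?thesis
    using assms unfolding prefix_iff_string_set by (auto simp: Suc_le_eq)
qed

text \<open>The search of a stage that starts at \<open>p\<close> and has its zeros at \<open>i\<close> and \<open>k\<close>. The first component of
  \<open>i\<close> consists of a program and the code of a string \<open>\<sigma>\<close> of length \<open>p\<close>, the state of the construction
  that the decoded set may have overwritten; \<open>w\<close> consists of a string and a witness that the program
  halts on it. Lemma \<open>search_iff\<close> is the intended meaning, of which this is a decidable form.\<close>

definition search :: "nat \<Rightarrow> nat \<Rightarrow> nat \<Rightarrow> nat \<Rightarrow> bool" where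
  "search p i k w \<longleftrightarrow>
     pi1 w \<in> range string_code \<and> halts (pi1 (pi1 i)) (pi1 w) (pi2 w) \<and>
     (\<forall>m<p. m \<in> bits (pi1 w) \<longleftrightarrow> m \<in> bits (pi2 (pi1 i))) \<and>
     entry_tail (pi1 w) k \<noteq> 0 \<and> block (bits (pi1 w)) p i \<and> block (bits (pi1 w)) (Suc i) k"

lemma search_iff:
  assumes "pi1 i = pr s (string_code \<sigma>)" "length \<sigma> < i" "i < k"
  shows "search (length \<sigma>) i k w \<longleftrightarrow>
    (\<exists>\<tau>. pi1 w = string_code \<tau> \<and> halts s (string_code \<tau>) (pi2 w) \<and> prefix (mark (mark \<sigma> i) k) \<tau>)"
  using assms
  by (auto simp: search_def prefix_mark_iff prefix_iff_string_set[of \<sigma>] not_le)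

definition string_length :: "nat \<Rightarrow> nat \<Rightarrow> bool" where
  "string_length c n \<longleftrightarrow> entry_tail c n = 0 \<and> (\<forall>m<n. entry_tail c m \<noteq> 0)"

lemma string_length_string_code [simp]: "string_length (string_code \<sigma>) n \<longleftrightarrow> n = length \<sigma>"
  unfolding string_length_def by (auto simp: not_le) (metis le_antisym le_refl not_le)

text \<open>The stage from \<open>p\<close> to \<open>q\<close>. Taking the least witness \<open>w\<close> makes the end of the stage a function
  of its start, without which \<open>G\<close> could have unintended starts.\<close>

definition next_start :: "nat set \<Rightarrow> nat set \<Rightarrow> nat \<Rightarrow> nat \<Rightarrow> nat \<Rightarrow> nat \<Rightarrow> nat \<Rightarrow> bool" where
  "next_start B G p i k w q \<longleftrightarrow> p < i \<and> i < k \<and> block G p i \<and> block G (Suc i) k \<and>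
     (if k \<in> B then search p i k w \<and> (\<forall>v<w. \<not> search p i k v) \<and> string_length (pi1 w) q
      else q = Suc k)"

lemma next_start_gt:
  assumes "next_start B G p i k w q" shows "k < q"
proof (cases "k \<in> B")
  case True
  with assms have "search p i k w" and q: "string_length (pi1 w) q"
    by (simp_all add: next_start_def)
  then obtain \<tau> where "pi1 w = string_code \<tau>" "entry_tail (pi1 w) k \<noteq> 0"
    unfolding search_def by blast
  with q show ?thesis by simp
qed (use assms in \<open>simp add: next_start_def\<close>)

lemma next_start_unique:
  assumes "next_start B G p i k w q" "next_start B G p i' k' w' q'"
  shows "q = q'"
proof -
  have "i = i'"
    using assms block_unique[of G p i i'] by (auto simp: next_start_def)
  moreover from this have "k = k'"
    using assms block_unique[of G "Suc i" k k'] by (auto simp: next_start_def)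
  moreover have "w = w'" if "k \<in> B"
    using assms that calculation by (metis next_start_def linorder_neqE_nat)
  ultimately show ?thesis
    using assms by (auto simp: next_start_def search_def split: if_splits)
qed

text \<open>A stage depends on the decoded set only below its end, since \<open>k < q\<close>. So an initial segment of a
  set has the same starts as the set, up to its length.\<close>

lemma next_start_cong:
  assumes "G \<inter> {..<q} = H \<inter> {..<q}" "next_start B G p i k w q"
  shows "next_start B H p i k w q"
proof -
  have "i < q" "k < q" using next_start_gt[OF assms(2)] assms(2) by (auto simp: next_start_def)
  then have "block H p i = block G p i" "block H (Suc i) k = block G (Suc i) k"
    using block_cong[OF assms(1)] by blast+
  then show ?thesis using assms(2) unfolding next_start_def by simp
qed

inductive start :: "nat set \<Rightarrow> nat set \<Rightarrow> nat \<Rightarrow> bool" for B G where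
  zero: "start B G 0"
| step: "start B G p \<Longrightarrow> next_start B G p i k w q \<Longrightarrow> start B G q"

lemma start_cong:
  "start B G p \<Longrightarrow> G \<inter> {..<p} = H \<inter> {..<p} \<Longrightarrow> start B H p"
proof (induction rule: start.induct)
  case zero
  show ?case by (rule start.zero)
next
  case (step p i k w q)
  have "p < q" using next_start_gt[OF step.hyps(2)] step.hyps(2) by (simp add: next_start_def)
  then have "{..<p} = {..<q} \<inter> {..<p}" by auto
  then have "G \<inter> {..<p} = H \<inter> {..<p}" using step.prems by (metis Int_assoc)
  then have "start B H p" by (rule step.IH)
  moreover have "next_start B H p i k w q" using step.prems step.hyps(2) by (rule next_start_cong)
  ultimately show ?case by (rule start.step)
qed

text \<open>The reading of the string coded by \<open>c\<close>, as a rule of inference. Facts are pairs of a start and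
  the data \<open>i\<close>, \<open>k\<close>, \<open>w\<close> of the stage that led to it: recorded in the conclusion, they turn the unbounded
  choice of these numbers into a decidable check. A stage has one premise, and the binary rule format
  receives it twice.\<close>

definition start_rule :: "nat set \<Rightarrow> nat \<Rightarrow> nat \<Rightarrow> nat \<Rightarrow> nat \<Rightarrow> bool" where
  "start_rule B c u u' v \<longleftrightarrow>
     next_start B (bits c) (pi1 u) (pi1 (pi2 v)) (pi1 (pi2 (pi2 v))) (pi2 (pi2 (pi2 v))) (pi1 v)"

lemma start_iff_derivable:
  "start B (bits c) p \<longleftrightarrow> (\<exists>t. derivable (\<lambda>u. pi1 u = 0) (start_rule B c) (pr p t))"
proof
  assume "start B (bits c) p"
  then show "\<exists>t. derivable (\<lambda>u. pi1 u = 0) (start_rule B c) (pr p t)"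
  proof induction
    case zero
    show ?case by (intro exI derivable.axiom) simp
  next
    case (step p i k w q)
    then obtain t where t: "derivable (\<lambda>u. pi1 u = 0) (start_rule B c) (pr p t)" by blast
    have "start_rule B c (pr p t) (pr p t) (pr q (pr i (pr k w)))"
      using step.hyps(2) by (simp add: start_rule_def)
    then show ?case using derivable.rule[OF t t] by blast
  qed
next
  assume "\<exists>t. derivable (\<lambda>u. pi1 u = 0) (start_rule B c) (pr p t)"
  moreover have "derivable (\<lambda>u. pi1 u = 0) (start_rule B c) u \<Longrightarrow> start B (bits c) (pi1 u)" for u
    by (induction rule: derivable.induct) (auto simp: start_rule_def intro: start.intros)
  ultimately show "start B (bits c) p" by fastforce
qed

lemma decidable_search:
  assumes "computable f" "computable g" "computable h" "computable k"
  shows "decidable (\<lambda>x. search (f x) (g x) (h x) (k x))"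
  unfolding search_def iff_conv_conj_imp
  by (intro rec_intros decidable_range_string_code decidable_halts decidable_mem_bits
      computable_entry_tail decidable_block assms computable_compose[OF assms(2)]
      computable_compose[OF assms(4)])

lemma decidable_start_rule:
  assumes "decidable (\<lambda>x. x \<in> B)"
  shows "decidable (\<lambda>z. start_rule B (pi1 z) (pi1 (pi2 z)) (pi1 (pi2 (pi2 z))) (pi2 (pi2 (pi2 z))))"
  unfolding start_rule_def next_start_def string_length_def
  by (intro rec_intros decidable_search decidable_block decidable_compose[OF assms]
      computable_entry_tail)

text \<open>The c.e. set of strings that witnesses the failure of 1-genericity.\<close>

lemma ce_strings_start_zero:
  assumes "decidable (\<lambda>x. x \<in> B)"
  shows "ce_strings {\<xi>. \<exists>p<length \<xi>. \<not> \<xi> ! p \<and> start B (string_set \<xi>) p}"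
proof -
  define S where "S z \<longleftrightarrow>
    (let c = pi1 z; d = pi1 (pi2 z); n = pi2 (pi2 z); p = pi1 (entry d n) in
      derivation (\<lambda>u. pi1 u = 0) (start_rule B c) d n \<and> entry_tail c p \<noteq> 0 \<and> p \<notin> bits c)" for z
  have "decidable S"
    unfolding S_def Let_def
    by (intro rec_intros computable_entry computable_entry_tail decidable_mem_bits
        decidable_derivation[where Ax = "\<lambda>a u. pi1 u = 0"] decidable_start_rule assms)
  moreover have "(\<exists>p<length \<xi>. \<not> \<xi> ! p \<and> start B (string_set \<xi>) p) \<longleftrightarrow>
      (\<exists>y. S (pr (string_code \<xi>) y))" for \<xi>
  proof -
    have "(\<exists>p<length \<xi>. \<not> \<xi> ! p \<and> start B (string_set \<xi>) p) \<longleftrightarrow>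
        (\<exists>p t. p < length \<xi> \<and> p \<notin> string_set \<xi> \<and>
          derivable (\<lambda>u. pi1 u = 0) (start_rule B (string_code \<xi>)) (pr p t))"
      using start_iff_derivable[of B "string_code \<xi>"] by (auto simp: string_set_def)
    also have "\<dots> \<longleftrightarrow> (\<exists>u. pi1 u < length \<xi> \<and> pi1 u \<notin> string_set \<xi> \<and>
          derivable (\<lambda>u. pi1 u = 0) (start_rule B (string_code \<xi>)) u)"
      by (metis pi_pr)
    also have "\<dots> \<longleftrightarrow> (\<exists>u. pi1 u < length \<xi> \<and> pi1 u \<notin> string_set \<xi> \<and> (\<exists>d n.
          derivation (\<lambda>u. pi1 u = 0) (start_rule B (string_code \<xi>)) d n \<and> entry d n = u))"
      unfolding derivable_iff_derivation ..
    also have "\<dots> \<longleftrightarrow> (\<exists>d n. S (pr (string_code \<xi>) (pr d n)))"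
      unfolding S_def by (auto simp: Let_def not_le)
    also have "\<dots> \<longleftrightarrow> (\<exists>y. S (pr (string_code \<xi>) y))" by (metis pi_pr(3))
    finally show ?thesis .
  qed
  ultimately show ?thesis using ce_strings_projection[of S] by simp
qed

text \<open>Since the end of a stage is determined by its start, the \<open>f n\<close> are the only starts of \<open>G\<close>, and
  each of them begins another stage, which puts it into \<open>G\<close>. So no initial segment of \<open>G\<close> has a zero
  at a start, whereas every one of them has an extension that does.\<close>

lemma not_one_generic_if_decoded:
  assumes B: "decidable (\<lambda>x. x \<in> B)"
    and f0: "f 0 = 0"
    and step: "\<And>n. \<exists>i k w. next_start B G (f n) i k w (f (Suc n))"
  shows "\<not> one_generic G"
proof
  define W where "W = {\<xi>. \<exists>p<length \<xi>. \<not> \<xi> ! p \<and> start B (string_set \<xi>) p}"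
  have f: "f n \<in> G \<and> f n < f (Suc n)" for n
  proof -
    obtain i k w where "next_start B G (f n) i k w (f (Suc n))" using step by blast
    from this next_start_gt[OF this] show ?thesis by (auto simp: next_start_def block_def)
  qed
  have start: "start B G (f n)" for n
  proof (induction n)
    case 0
    show ?case by (simp add: f0 start.zero)
  next
    case (Suc n)
    then show ?case using step start.step by blast
  qed
  have only: "start B G p \<Longrightarrow> \<exists>n. p = f n" for p
  proof (induction rule: start.induct)
    case zero
    show ?case using f0 by metis
  next
    case (step p i k w q)
    then show ?case using assms(3) next_start_unique by blast
  qed
  assume "one_generic G"
  moreover have "ce_strings W" unfolding W_def by (rule ce_strings_start_zero[OF B])
  ultimately obtain \<sigma> where \<sigma>: "initial_segment \<sigma> G" "\<sigma> \<in> W \<or> (\<forall>\<tau>. prefix \<sigma> \<tau> \<longrightarrow> \<tau> \<notin> W)"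
    unfolding one_generic_def by blast
  have "\<sigma> \<notin> W"
  proof
    assume "\<sigma> \<in> W"
    then obtain p where p: "p < length \<sigma>" "\<not> \<sigma> ! p" "start B (string_set \<sigma>) p"
      unfolding W_def by blast
    have "string_set \<sigma> \<inter> {..<p} = G \<inter> {..<p}"
      using \<sigma>(1) p(1) by (auto simp: initial_segment_def string_set_def)
    then have "start B G p" using p(3) start_cong by blast
    then have "p \<in> G" using only f by blast
    then show False using \<sigma>(1) p by (simp add: initial_segment_def)
  qed
  moreover have "\<exists>\<tau>. prefix \<sigma> \<tau> \<and> \<tau> \<in> W"
  proof -
    let ?n = "length \<sigma>"
    have "strict_mono f" using f by (simp add: strict_mono_Suc_iff)
    then have n: "?n \<le> f ?n" by (rule strict_mono_imp_increasing)
    define \<tau> where "\<tau> = map (\<lambda>m. m \<in> G) [0..<f ?n] @ [False]"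
    have "string_set \<tau> \<inter> {..<f ?n} = G \<inter> {..<f ?n}"
      by (auto simp: \<tau>_def string_set_def nth_append)
    then have "start B (string_set \<tau>) (f ?n)" using start start_cong by metis
    then have "\<tau> \<in> W"
      unfolding W_def by (auto simp: \<tau>_def nth_append intro!: exI[of _ "f ?n"])
    moreover have "prefix \<sigma> \<tau>"
      using n \<sigma>(1) unfolding prefix_iff_string_set
      by (auto simp: \<tau>_def string_set_def nth_append initial_segment_def)
    ultimately show ?thesis by blast
  qed
  ultimately show False using \<sigma>(2) by blast
qed

section \<open>The construction\<close>

lemma block_Un:
  assumes "initial_segment \<tau> A" "b < length \<tau>" "b \<notin> X" "block (string_set \<tau>) a b"
  shows "block (A \<union> X) a b"
proof -
  have "string_set \<tau> \<inter> {..<length \<tau>} = A \<inter> {..<length \<tau>}"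
    using assms(1) by (auto simp: initial_segment_def string_set_def)
  then have "block A a b" using block_cong assms(2,4) by blast
  then show ?thesis using assms(3) by (auto simp: block_def)
qed

definition meets :: "nat \<Rightarrow> bool list \<Rightarrow> bool" where
  "meets s \<tau> \<longleftrightarrow> (\<exists>w. halts s (string_code \<tau>) w)"

definition decides :: "nat \<Rightarrow> bool list \<Rightarrow> bool" where
  "decides s \<sigma> \<longleftrightarrow> meets s \<sigma> \<or> (\<forall>\<tau>. prefix \<sigma> \<tau> \<longrightarrow> \<not> meets s \<tau>)"

text \<open>One stage of the construction. The next start must be predicted for \<open>A \<union> X\<close> with any \<open>A\<close> that
  extends the new string \<open>\<sigma>'\<close>, as the rest of \<open>A\<close> is still to be determined.\<close>

lemma extension_step:
  assumes B: "decidable (\<lambda>x. x \<in> B)" "infinite (X \<inter> B)" "infinite (- B)"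
    and X: "\<And>C. ce_set C \<Longrightarrow> infinite C \<Longrightarrow> \<not> C \<subseteq> X"
  obtains \<sigma>' where "prefix \<sigma> \<sigma>'"
    and "decides s \<sigma>'"
    and "\<And>A. initial_segment \<sigma>' A \<Longrightarrow> \<exists>i k w. next_start B (A \<union> X) (length \<sigma>) i k w (length \<sigma>')"
proof -
  let ?e = "pr s (string_code \<sigma>)"
  have avoid: "\<exists>j\<in>D. n < j \<and> j \<notin> X" if "decidable (\<lambda>x. x \<in> D)" "infinite D" for D n
  proof -
    let ?D = "{j. j \<in> D \<and> n < j}"
    have "D \<subseteq> ?D \<union> {..n}" by auto
    then have "infinite ?D" using that(2) by (meson finite_UnI finite_atMost finite_subset)
    moreover have "ce_set ?D"
      by (rule ce_set_decidable, unfold mem_Collect_eq) (intro rec_intros that(1))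
    ultimately have "\<not> ?D \<subseteq> X" by (rule X[rotated])
    then show ?thesis by auto
  qed
  have "decidable (\<lambda>i. i \<in> {i. pi1 i = ?e})"
    unfolding mem_Collect_eq by (intro rec_intros)
  then obtain i where i: "pi1 i = ?e" "length \<sigma> < i" "i \<notin> X"
    using avoid[OF _ infinite_pi1_fibre, of ?e "length \<sigma>"] by auto
  have notB: "\<exists>j. j \<notin> B \<and> n < j \<and> j \<notin> X" for n
    using avoid[of "- B" n] B(3) decidable_not[OF B(1)] by auto
  let ?\<rho> = "mark \<sigma> i"
  have len: "length ?\<rho> = Suc i" using i(2) by simp
  have \<rho>: "prefix \<sigma> ?\<rho>" by (simp add: mark_def)
  \<comment> \<open>Either the zero at \<open>k\<close> stays visible and starts a search that succeeds, or \<open>X\<close> hides it and the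
    algorithm does not search for an extension that does not exist.\<close>
  consider (found) k \<tau> where "i < k" "k \<in> B" "k \<notin> X" "prefix (mark ?\<rho> k) \<tau>" "meets s \<tau>"
    | (hidden) k j where "i < k" "k \<in> B" "k \<in> X" "k < j" "j \<notin> B" "j \<notin> X"
        "\<And>\<tau>. prefix (mark (mark ?\<rho> k) j) \<tau> \<Longrightarrow> \<not> meets s \<tau>"
  proof -
    \<comment> \<open>If both fail, this set is the part of \<open>X \<inter> B\<close> beyond \<open>i\<close>.\<close>
    define C where "C = {k. i < k \<and> k \<in> B \<and>
      (\<exists>j \<tau>. k < j \<and> j \<notin> B \<and> prefix (mark (mark ?\<rho> k) j) \<tau> \<and> meets s \<tau>)}"
    \<comment> \<open>The defining condition of \<open>C\<close> in decidable form, \<open>c\<close> being the code of \<open>\<tau>\<close> and \<open>w\<close> the witness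
      that it is in the \<open>s\<close>-th set.\<close>
    let ?S = "\<lambda>k j c w. i < k \<and> k \<in> B \<and> k < j \<and> j \<notin> B \<and>
      c \<in> range string_code \<and> halts s c w \<and> entry_tail c j \<noteq> 0 \<and>
      (\<forall>m<length \<sigma>. m \<in> bits c \<longleftrightarrow> m \<in> string_set \<sigma>) \<and>
      block (bits c) (length \<sigma>) i \<and> block (bits c) (Suc i) k \<and> block (bits c) (Suc k) j"
    let ?R = "\<lambda>z. ?S (pi1 z) (pi1 (pi2 z)) (pi1 (pi2 (pi2 z))) (pi2 (pi2 (pi2 z)))"
    have "decidable ?R"
      unfolding iff_conv_conj_imp bits_string_code[symmetric]
      by (intro rec_intros decidable_range_string_code decidable_halts decidable_mem_bits
          decidable_block computable_entry_tail decidable_compose[OF B(1)])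
    moreover have "C = {k. \<exists>y. ?R (pr k y)}"
    proof -
      have "(i < k \<and> k \<in> B \<and> k < j \<and> j \<notin> B \<and> prefix (mark (mark ?\<rho> k) j) \<tau> \<and>
          halts s (string_code \<tau>) w) \<longleftrightarrow> ?S k j (string_code \<tau>) w" for k j \<tau> w
      proof (cases "i < k \<and> k < j")
        case True
        then show ?thesis
          using i(2) by (auto simp: prefix_mark_iff prefix_iff_string_set[of \<sigma>] not_le)
      qed auto
      then have "k \<in> C \<longleftrightarrow> (\<exists>j c w. ?S k j c w)" for k
        unfolding C_def meets_def by blast
      also have "(\<exists>j c w. ?S k j c w) \<longleftrightarrow> (\<exists>y. ?R (pr k y))" for k
        using ex_triple[of "?S k"] by simp
      finally show ?thesis by blast
    qed
    ultimately have ce: "ce_set C" unfolding ce_set_def by blast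
    show thesis
    proof (cases "C \<subseteq> X")
      case False
      then obtain k j \<tau> where k: "k \<notin> X" "i < k" "k \<in> B" "k < j"
        "prefix (mark (mark ?\<rho> k) j) \<tau>" "meets s \<tau>"
        unfolding C_def by blast
      have "prefix (mark ?\<rho> k) \<tau>"
        using k(5) by (rule prefix_order.trans[rotated]) (simp add: mark_def)
      with k show thesis by (intro found)
    next
      case True
      then have "finite C" using X ce by blast
      then have "finite (C \<union> {..i})" by simp
      then obtain k where k: "k \<in> X \<inter> B" "k \<notin> C \<union> {..i}"
        using B(2) by (meson finite_subset subsetI)
      obtain j where j: "j \<notin> B" "k < j" "j \<notin> X" using notB by blast
      have "\<not> meets s \<tau>" if "prefix (mark (mark ?\<rho> k) j) \<tau>" for \<tau>
        using k j that unfolding C_def by auto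
      then show thesis using k j by (intro hidden[of k j]) auto
    qed
  qed
  then show thesis
  proof cases
    case (found k \<tau>)
    have search: "search (length \<sigma>) i k v \<longleftrightarrow> (\<exists>\<tau>. pi1 v = string_code \<tau> \<and>
        halts s (string_code \<tau>) (pi2 v) \<and> prefix (mark ?\<rho> k) \<tau>)" for v
      by (rule search_iff[OF i(1,2) found(1)])
    \<comment> \<open>The search need not return \<open>\<tau>\<close>, and \<open>A\<close> has to follow the string that it does return.\<close>
    obtain v where "halts s (string_code \<tau>) v" using found(5) unfolding meets_def by blast
    then have "search (length \<sigma>) i k (pr (string_code \<tau>) v)"
      unfolding search using found(4) by auto
    then obtain w where w: "search (length \<sigma>) i k w" "\<forall>v<w. \<not> search (length \<sigma>) i k v"
      by (metis exists_least_iff)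
    then obtain \<sigma>' where \<sigma>': "pi1 w = string_code \<sigma>'" "halts s (string_code \<sigma>') (pi2 w)"
      "prefix (mark ?\<rho> k) \<sigma>'"
      unfolding search by blast
    have pre: "prefix \<sigma> \<sigma>'" "i < length \<sigma>'" "k < length \<sigma>'"
      "block (string_set \<sigma>') (length \<sigma>) i" "block (string_set \<sigma>') (Suc i) k"
      using \<sigma>'(3) found(1) i(2) by (auto simp: prefix_mark_iff)
    show thesis
    proof (rule that)
      show "prefix \<sigma> \<sigma>'" by (rule pre)
      show "decides s \<sigma>'" using \<sigma>'(2) unfolding decides_def meets_def by blast
      fix A assume A: "initial_segment \<sigma>' A"
      have "next_start B (A \<union> X) (length \<sigma>) i k w (length \<sigma>')"
        unfolding next_start_def
        using found(1-3) i block_Un[OF A] pre w \<sigma>'(1) by simp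
      then show "\<exists>i k w. next_start B (A \<union> X) (length \<sigma>) i k w (length \<sigma>')" by blast
    qed
  next
    case (hidden k j)
    let ?\<sigma> = "mark (mark ?\<rho> k) j"
    have "prefix \<sigma> \<tau> \<and> block (string_set \<tau>) (length \<sigma>) i \<and> block (string_set \<tau>) (Suc i) k \<and>
        block (string_set \<tau>) (Suc k) j" if "prefix ?\<sigma> \<tau>" for \<tau>
      using that hidden(1,4) i(2) by (auto simp: prefix_mark_iff)
    from this[OF prefix_order.refl]
    have pre: "prefix \<sigma> ?\<sigma>" "length ?\<sigma> = Suc j" "block (string_set ?\<sigma>) (length \<sigma>) i"
      "block (string_set ?\<sigma>) (Suc i) k" "block (string_set ?\<sigma>) (Suc k) j"
      using hidden(1,4) i(2) by auto
    show thesis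
    proof (rule that)
      show "prefix \<sigma> ?\<sigma>" by (rule pre)
      show "decides s ?\<sigma>" using hidden(7) unfolding decides_def by blast
      fix A assume A: "initial_segment ?\<sigma> A"
      have ones: "block (A \<union> X) (Suc k) j" "block (A \<union> X) (length \<sigma>) i"
        using block_Un[OF A] pre hidden i by auto
      \<comment> \<open>The zero of \<open>A\<close> at \<open>k\<close> is filled by \<open>X\<close>, so the two blocks of ones merge.\<close>
      have "m \<in> A \<union> X" if "Suc i \<le> m" "m < j" for m
      proof -
        have "m \<in> string_set ?\<sigma>" if "m \<noteq> k"
          using \<open>Suc i \<le> m\<close> \<open>m < j\<close> that pre(4,5)
          by (cases "m < k") (auto simp: block_def)
        then have "m \<in> A" if "m \<noteq> k"
          using that A by (auto simp: initial_segment_def string_set_def)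
        then show ?thesis using hidden(3) by blast
      qed
      then have "block (A \<union> X) (Suc i) j" using ones(1) by (auto simp: block_def)
      then have "next_start B (A \<union> X) (length \<sigma>) i j 0 (length ?\<sigma>)"
        unfolding next_start_def using ones(2) hidden(1,4,5) i(2) pre(2) by simp
      then show "\<exists>i k w. next_start B (A \<union> X) (length \<sigma>) i k w (length ?\<sigma>)" by blast
    qed
  qed
qed

lemma one_generic_limit:
  assumes chain: "\<And>n. prefix (S n) (S (Suc n))"
    and decides: "\<And>s. decides s (S (Suc s))"
  obtains A where "one_generic A" "\<And>n. initial_segment (S n) A"
proof
  define A where "A = (\<Union>n. string_set (S n))"
  have mono: "prefix (S m) (S n)" if "m \<le> n" for m n
    using chain that by (rule prefix_order.lift_Suc_mono_le)
  show seg: "initial_segment (S n) A" for n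
  proof -
    have "m \<in> string_set (S n)" if "m < length (S n)" "m \<in> string_set (S n')" for m n'
    proof -
      have "m < length (S n')" using that(2) by (simp add: string_set_def)
      then show ?thesis
        using mono[of n n'] mono[of n' n] that nle_le[of n n'] unfolding prefix_iff_string_set
        by blast
    qed
    then have "m \<in> string_set (S n) \<longleftrightarrow> m \<in> A" if "m < length (S n)" for m
      using that unfolding A_def by blast
    then show ?thesis by (auto simp: initial_segment_def string_set_def)
  qed
  show "one_generic A"
    unfolding one_generic_def
  proof (intro allI impI)
    fix W assume "ce_strings W"
    then obtain s where "\<And>\<sigma>. \<sigma> \<in> W \<longleftrightarrow> meets s \<sigma>"
      unfolding meets_def using ce_strings_index by blast
    then show "\<exists>\<sigma>. initial_segment \<sigma> A \<and> (\<sigma> \<in> W \<or> (\<forall>\<tau>. prefix \<sigma> \<tau> \<longrightarrow> \<tau> \<notin> W))"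
      using seg[of "Suc s"] decides[of s] unfolding decides_def by blast
  qed
qed

lemma exists_one_generic: "\<exists>A. one_generic A"
proof -
  have ex: "\<exists>\<sigma>'. prefix \<sigma> \<sigma>' \<and> decides s \<sigma>'" for s \<sigma>
    unfolding decides_def by blast
  define ext where "ext s \<sigma> = (SOME \<sigma>'. prefix \<sigma> \<sigma>' \<and> decides s \<sigma>')" for s \<sigma>
  have ext: "prefix \<sigma> (ext s \<sigma>) \<and> decides s (ext s \<sigma>)" for s \<sigma>
    unfolding ext_def using ex by (rule someI_ex)
  obtain A where "one_generic A"
    by (rule one_generic_limit[of "rec_nat [] ext"]) (simp_all add: ext)
  then show ?thesis by blast
qed

lemma exists_one_generic_Un_decoded:
  assumes B: "decidable (\<lambda>x. x \<in> B)" "infinite (X \<inter> B)" "infinite (- B)"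
    and X: "\<And>C. ce_set C \<Longrightarrow> infinite C \<Longrightarrow> \<not> C \<subseteq> X"
  shows "\<exists>A. one_generic A \<and> \<not> one_generic (A \<union> X)"
proof -
  define good where "good s \<sigma> \<sigma>' \<longleftrightarrow> prefix \<sigma> \<sigma>' \<and> decides s \<sigma>' \<and>
    (\<forall>A. initial_segment \<sigma>' A \<longrightarrow>
      (\<exists>i k w. next_start B (A \<union> X) (length \<sigma>) i k w (length \<sigma>')))" for s \<sigma> \<sigma>'
  have ex: "\<exists>\<sigma>'. good s \<sigma> \<sigma>'" for s \<sigma>
    by (rule extension_step[OF B X, of \<sigma> s]) (unfold good_def, blast+)
  define ext where "ext s \<sigma> = (SOME \<sigma>'. good s \<sigma> \<sigma>')" for s \<sigma>
  have ext: "good s \<sigma> (ext s \<sigma>)" for s \<sigma>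
    unfolding ext_def using ex by (rule someI_ex)
  define S where "S = rec_nat [] ext"
  have good: "good s (S s) (S (Suc s))" for s using ext by (simp add: S_def)
  obtain A where A: "one_generic A" "\<And>n. initial_segment (S n) A"
    by (rule one_generic_limit[of S]) (use good in \<open>auto simp: good_def\<close>)
  have "\<not> one_generic (A \<union> X)"
  proof (rule not_one_generic_if_decoded[OF B(1), of "\<lambda>n. length (S n)"])
    show "length (S 0) = 0" by (simp add: S_def)
    show "\<exists>i k w. next_start B (A \<union> X) (length (S n)) i k w (length (S (Suc n)))" for n
      using good[of n] A(2)[of "Suc n"] unfolding good_def by blast
  qed
  with A(1) show ?thesis by blast
qed

theorem theorem3p2:
  "(\<forall>X::nat set. infinite X \<longrightarrow> (\<exists>A::nat set. one_generic A \<and> \<not> one_generic (A \<union> X))) \<and>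
   \<not> (\<exists>X::nat set. infinite X \<and> one_generic_union_set X)"
proof -
  have "\<exists>A. one_generic A \<and> \<not> one_generic (A \<union> X)" if X: "infinite X" for X
  proof (cases "\<exists>C. ce_set C \<and> infinite C \<and> C \<subseteq> X")
    case True
    then show ?thesis
      using exists_one_generic not_one_generic_if_infinite_ce_subset by (metis le_supI2)
  next
    case False
    \<comment> \<open>Of two complementary infinite computable sets, at least one meets \<open>X\<close> in an infinite set.\<close>
    let ?E = "{k. pi1 k = 0}"
    have dec: "decidable (\<lambda>k. k \<in> ?E)" "decidable (\<lambda>k. k \<in> - ?E)"
      unfolding mem_Collect_eq Compl_iff by (intro rec_intros)+
    have "infinite (- ?E)"
      by (rule infinite_super[OF _ infinite_pi1_fibre[of 1]]) auto
    then have inf: "infinite (- ?E)" "infinite (- (- ?E))"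
      using infinite_pi1_fibre[of 0] by simp_all
    have "X = (X \<inter> ?E) \<union> (X \<inter> - ?E)" by blast
    with X have "infinite (X \<inter> ?E) \<or> infinite (X \<inter> - ?E)" by (metis finite_UnI)
    then show ?thesis
      using exists_one_generic_Un_decoded[of ?E X] exists_one_generic_Un_decoded[of "- ?E" X]
        dec inf False by blast
  qed
  then show ?thesis unfolding one_generic_union_set_def by blast
qed

end
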